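(* Let $K\subset\mathbb{R}^2$ be a convex body of class $C^2_+$ with support function $h$, let $x_0\in\partial K$ and let $n_{\vartheta_0}$ be the outer unit normal to $K$ at $x_0$. The left and right involutes of $\partial K$ starting at $x_0$, parametrized by the angle $\vartheta$ of the outer normal $n_\vartheta$ to $K$ (with $\vartheta=\vartheta_0$ at the starting point), are $$i_{l,x_0}(\vartheta)=h(\vartheta)n_\vartheta-\Big(\int_{\vartheta_0}^\vartheta h(\tau)\,d\tau-\dot h(\vartheta_0)\Big)t_\vartheta,\qquad\vartheta\ge\vartheta_0,$$ $$i_{r,x_0}(\vartheta)=h(\vartheta)n_\vartheta-\Big(\int_{\vartheta_0}^\vartheta h(\tau)\,d\tau-\dot h(\vartheta_0)\Big)t_\vartheta,\qquad\vartheta\le\vartheta_0.$$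
   Context: $n_\vartheta=(\cos\vartheta,\sin\vartheta)$, $t_\vartheta=(-\sin\vartheta,\cos\vartheta)$, $h(\vartheta)=\max_{y\in K}\langle n_\vartheta,y\rangle$. $C^2_+$ means that $\partial K$ is of class $C^2$ with positive curvature. For an arc-length parametrization $s\mapsto x(s)$ of $\partial K$ (extended periodically to $\mathbb{R}$) with $x(s_0)=x_0$, the involute starting at $x_0$ is $i(s)=x(s)-(s-s_0)x'(s)$, $s\ge s_0$. It is called the left involute $i_{l,x_0}$ when $x(\cdot)$ is counterclockwise and the right involute $i_{r,x_0}$ when $x(\cdot)$ is clockwise. The point $i(s)$ is assigned the parameter $\vartheta=\vartheta(s)$, where $s\mapsto\vartheta(s)$ is the continuous function with $\vartheta(s_0)=\vartheta_0$ such that $n_{\vartheta(s)}$ is the outer unit normal to $K$ at $x(s)$ (so $\vartheta$ increases for the left involute and decreases for the right one). *)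

theory Defs
  imports "HOL-Analysis.Analysis"
begin

definition nvec :: "real \<Rightarrow> real^2" where
  "nvec \<theta> = vector [cos \<theta>, sin \<theta>]"

definition tvec :: "real \<Rightarrow> real^2" where
  "tvec \<theta> = vector [- sin \<theta>, cos \<theta>]"

definition convex_body :: "(real^2) set \<Rightarrow> bool" where
  "convex_body K \<longleftrightarrow> convex K \<and> compact K \<and> interior K \<noteq> {}"

text \<open>For compact nonempty \<open>K\<close> the supremum is a maximum.\<close>

definition support_fun :: "(real^2) set \<Rightarrow> real \<Rightarrow> real" where
  "support_fun K \<theta> = (SUP y\<in>K. nvec \<theta> \<bullet> y)"

definition outer_unit_normal :: "(real^2) set \<Rightarrow> real^2 \<Rightarrow> real^2 \<Rightarrow> bool" where
  "outer_unit_normal K p u \<longleftrightarrow> p \<in> frontier K \<and> norm u = 1 \<and> (\<forall>y\<in>K. u \<bullet> y \<le> u \<bullet> p)"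

abbreviation vel :: "(real \<Rightarrow> real^2) \<Rightarrow> real \<Rightarrow> real^2" where
  "vel c t \<equiv> vector_derivative c (at t)"

definition regular_C2_on :: "(real \<Rightarrow> real^2) \<Rightarrow> real set \<Rightarrow> bool" where
  "regular_C2_on c I \<longleftrightarrow>
     c C1_differentiable_on I \<and> vel c C1_differentiable_on I \<and> (\<forall>t\<in>I. vel c t \<noteq> 0)"

definition curvature :: "(real \<Rightarrow> real^2) \<Rightarrow> real \<Rightarrow> real" where
  "curvature c t = \<bar>det (vector [vel c t, vel (vel c) t] :: real^2^2)\<bar> / norm (vel c t) ^ 3"

text \<open>
  The frontier is, near each of its points, a regular \<open>C\<^sup>2\<close> arc of positive curvature.
  The curvature is unsigned; the frontier of a convex set never bends away from the set, so
  this agrees with positivity of the curvature taken with respect to the inner normal.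
\<close>

definition C2_plus :: "(real^2) set \<Rightarrow> bool" where
  "C2_plus K \<longleftrightarrow>
     (\<forall>p\<in>frontier K. \<exists>U c g. open U \<and> p \<in> U \<and>
        homeomorphism {-1<..<1} (frontier K \<inter> U) c g \<and>
        regular_C2_on c {-1<..<1} \<and> (\<forall>t\<in>{-1<..<1}. curvature c t > 0))"

definition arc_length_param :: "(real^2) set \<Rightarrow> (real \<Rightarrow> real^2) \<Rightarrow> bool" where
  "arc_length_param K x \<longleftrightarrow>
     (\<forall>s. x differentiable (at s) \<and> norm (vel x s) = 1) \<and>
     (\<exists>L>0. (\<forall>s. x (s + L) = x s) \<and> inj_on x {0..<L} \<and> x ` {0..<L} = frontier K)"

text \<open>
  The polar angle of \<open>x s\<close> about a point \<open>y\<close> has derivative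
  \<open>det (x s - y, x' s) / |x s - y|\<^sup>2\<close>: the curve runs counterclockwise (clockwise) if it
  does so around every interior point.
\<close>

definition counterclockwise :: "(real^2) set \<Rightarrow> (real \<Rightarrow> real^2) \<Rightarrow> bool" where
  "counterclockwise K x \<longleftrightarrow>
     (\<forall>y\<in>interior K. \<forall>s. det (vector [x s - y, vel x s] :: real^2^2) > 0)"

definition clockwise :: "(real^2) set \<Rightarrow> (real \<Rightarrow> real^2) \<Rightarrow> bool" where
  "clockwise K x \<longleftrightarrow>
     (\<forall>y\<in>interior K. \<forall>s. det (vector [x s - y, vel x s] :: real^2^2) < 0)"

definition involute :: "(real \<Rightarrow> real^2) \<Rightarrow> real \<Rightarrow> real \<Rightarrow> real^2" where
  "involute x s0 s = x s - (s - s0) *\<^sub>R vel x s"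

definition normal_angle ::
    "(real^2) set \<Rightarrow> (real \<Rightarrow> real^2) \<Rightarrow> real \<Rightarrow> real \<Rightarrow> (real \<Rightarrow> real) \<Rightarrow> bool" where
  "normal_angle K x s0 \<theta>0 \<phi> \<longleftrightarrow>
     continuous_on {s0..} \<phi> \<and> \<phi> s0 = \<theta>0 \<and>
     (\<forall>s\<ge>s0. outer_unit_normal K (x s) (nvec (\<phi> s)))"

text \<open>
  The involute reparametrized by the angle; meaningful for \<open>\<alpha> \<in> \<phi> ` {s0..}\<close> when \<open>\<phi>\<close> is
  injective on \<open>{s0..}\<close>.
\<close>

definition angle_involute :: "(real \<Rightarrow> real^2) \<Rightarrow> real \<Rightarrow> (real \<Rightarrow> real) \<Rightarrow> real \<Rightarrow> real^2" where
  "angle_involute x s0 \<phi> \<alpha> = involute x s0 (inv_into {s0..} \<phi> \<alpha>)"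

end

theory Submission imports Defs begin

text \<open>
  Let \<open>K\<close> have support function \<open>h\<close>. Positive curvature keeps the frontier of \<open>K\<close> from containing
  a segment, so the maximum defining \<open>h \<theta>\<close> is attained at a single point \<open>p \<theta>\<close>, which moves
  continuously with \<open>\<theta>\<close>; hence \<open>h\<close> is differentiable with \<open>h' \<theta> = \<langle>t\<^sub>\<theta>, p \<theta>\<rangle>\<close>, and
  \<open>p = h n + h' t\<close> (\<open>support_fun_DERIV\<close>).

  Along an arc-length parametrization \<open>x\<close> with normal angle \<open>\<phi>\<close> one has \<open>x s = p (\<phi> s)\<close> and
  \<open>x' s = \<sigma> t\<close> at the angle \<open>\<phi> s\<close>, where \<open>\<sigma> = 1\<close> for a counterclockwise and \<open>\<sigma> = - 1\<close> for a
  clockwise curve. The involute \<open>x - (s - s0) x'\<close> therefore has normal component \<open>h (\<phi> s)\<close> and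
  tangential component \<open>h' (\<phi> s) - \<sigma> (s - s0)\<close>, and the theorem amounts to
  \<open>h' (\<phi> s) + H (\<phi> s) - \<sigma> (s - s0) = h' \<theta>0\<close>, where \<open>H\<close> is the primitive of \<open>h\<close> vanishing at
  \<open>\<theta>0\<close>. This is the radius of curvature formula \<open>\<sigma> ds / d\<theta> = h + h''\<close> in integrated form.

  Instead of passing through \<open>h''\<close> and \<open>\<phi>'\<close>, the left side is estimated directly: between parameters
  \<open>s \<le> t\<close> at which the angle differs by \<open>\<delta>\<close> it changes by at most a constant times
  \<open>\<delta> (t - s) + \<delta>\<^sup>2\<close>, which is quadratic in the increment of the monotone function
  \<open>s + \<sigma> \<phi> s\<close>. Such a function is constant (\<open>constant_of_quadratic_increments\<close>).

  The angle is strictly monotone because otherwise, beyond a maximum of \<open>\<sigma> \<phi>\<close>, the curve could not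
  leave the supporting line (\<open>angle_strict_mono\<close>), and each period adds at least a full turn
  to it, so it takes all values on its side of \<open>\<theta>0\<close> (\<open>angle_surj\<close>).
\<close>

section \<open>The rotating frame\<close>

lemma nvec_component [simp]: "nvec \<theta> $ 1 = cos \<theta>" "nvec \<theta> $ 2 = sin \<theta>"
  by (simp_all add: nvec_def)

lemma tvec_component [simp]: "tvec \<theta> $ 1 = - sin \<theta>" "tvec \<theta> $ 2 = cos \<theta>"
  by (simp_all add: tvec_def)

lemma inner_nvec: "nvec \<theta> \<bullet> y = cos \<theta> * y$1 + sin \<theta> * y$2"
  by (simp add: inner_vec_def sum_2)

lemma inner_tvec: "tvec \<theta> \<bullet> y = cos \<theta> * y$2 - sin \<theta> * y$1"
  by (simp add: inner_vec_def sum_2)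

lemma nvec_inner_tvec: "nvec a \<bullet> tvec b = sin (a - b)"
  by (simp add: inner_nvec sin_diff algebra_simps)

lemma tvec_inner_tvec: "tvec a \<bullet> tvec b = cos (a - b)"
  by (simp add: inner_tvec cos_diff algebra_simps)

lemma nvec_inner_nvec: "nvec a \<bullet> nvec b = cos (a - b)"
  by (simp add: inner_nvec cos_diff algebra_simps)

lemma norm_nvec [simp]: "norm (nvec a) = 1"
  by (simp add: norm_eq_sqrt_inner nvec_inner_nvec)

lemma norm_tvec [simp]: "norm (tvec a) = 1"
  by (simp add: norm_eq_sqrt_inner tvec_inner_tvec)

lemma frame_decomposition:
  "v = (nvec \<theta> \<bullet> v) *\<^sub>R nvec \<theta> + (tvec \<theta> \<bullet> v) *\<^sub>R tvec \<theta>"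
proof -
  have *: "cos \<theta> * (cos \<theta> * a) + sin \<theta> * (sin \<theta> * a) = a" for a
    using distrib_left[of a "(cos \<theta>)\<^sup>2" "(sin \<theta>)\<^sup>2"] by (simp add: power2_eq_square mult_ac)
  show ?thesis
    by (simp add: vec_eq_iff forall_2 inner_nvec inner_tvec algebra_simps *)
qed

lemma det_tvec: "det (vector [w, a *\<^sub>R tvec \<theta>] :: real^2^2) = a * (nvec \<theta> \<bullet> w)"
  by (simp add: det_2 inner_nvec algebra_simps)

lemma DERIV_inner_nvec: "((\<lambda>\<theta>. nvec \<theta> \<bullet> y) has_real_derivative tvec \<theta> \<bullet> y) (at \<theta> within S)"
  unfolding inner_nvec inner_tvec by (auto intro!: derivative_eq_intros)

lemma DERIV_inner_tvec: "((\<lambda>\<theta>. tvec \<theta> \<bullet> y) has_real_derivative - (nvec \<theta> \<bullet> y)) (at \<theta> within S)"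
  unfolding inner_nvec inner_tvec by (auto intro!: derivative_eq_intros)

lemma continuous_on_nvec: "continuous_on S nvec"
proof -
  have "continuous_on S (\<lambda>\<theta>. nvec \<theta> $ i)" for i
    using exhaust_2[of i] continuous_on_cos[OF continuous_on_id] continuous_on_sin[OF continuous_on_id]
    by (elim disjE) simp_all
  then show ?thesis
    using continuous_on_vec_lambda[of S "\<lambda>i \<theta>. nvec \<theta> $ i"] by simp
qed

lemma nvec_Lipschitz: "\<bar>nvec a \<bullet> v - nvec b \<bullet> v\<bar> \<le> norm v * \<bar>a - b\<bar>"
proof -
  have "norm (tvec \<theta> \<bullet> v) \<le> norm v" for \<theta>
    using Cauchy_Schwarz_ineq2[of "tvec \<theta>" v] by simp
  then show ?thesis
    using field_differentiable_bound[OF convex_UNIV DERIV_inner_nvec, of v "norm v" a b] by simp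
qed

section \<open>Support points\<close>

lemma interior_less_support:
  fixes K :: "'a::euclidean_space set"
  assumes "z \<in> interior K" and "u \<noteq> 0" and "\<forall>y\<in>K. u \<bullet> y \<le> b"
  shows "u \<bullet> z < b"
proof -
  obtain e where e: "e > 0" "cball z e \<subseteq> K"
    using assms(1) mem_interior_cball by blast
  have "z + (e / norm u) *\<^sub>R u \<in> K"
    using e assms(2) by (intro subsetD[OF e(2)]) (simp add: dist_norm)
  then have "u \<bullet> (z + (e / norm u) *\<^sub>R u) \<le> b"
    using assms(3) by blast
  moreover have "u \<bullet> ((e / norm u) *\<^sub>R u) > 0"
    using e assms(2) by simp
  ultimately show ?thesis by (simp add: inner_add_right)
qed

text \<open>
  A local \<open>C\<^sup>2\<close> parametrization \<open>c\<close> of a flat piece of frontier satisfies \<open>\<langle>u, c\<rangle> = b\<close> on a whole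
  parameter interval, so that \<open>c'\<close> and \<open>c''\<close> are both orthogonal to \<open>u\<close>, hence parallel, and the
  curvature vanishes.
\<close>

lemma C2_plus_no_segment:
  assumes "C2_plus K" and "p \<noteq> q" and "u \<noteq> 0"
    and "closed_segment p q \<subseteq> frontier K" and flat: "\<And>z. z \<in> closed_segment p q \<Longrightarrow> u \<bullet> z = b"
  shows False
proof -
  obtain U c g where U: "open U" "p \<in> U"
    and hom: "homeomorphism {-1<..<1} (frontier K \<inter> U) c g"
    and reg: "regular_C2_on c {-1<..<1}" and curv: "\<forall>t\<in>{-1<..<1}. curvature c t > 0"
    using assms(1) assms(4) unfolding C2_plus_def by (meson ends_in_segment(1) subsetD)
  obtain e where e: "e > 0" "cball p e \<subseteq> U"
    using U open_contains_cball by blast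
  \<comment> \<open>Shorten the segment to a piece \<open>[p, r]\<close> that lies inside the chart.\<close>
  define d where "d = min 1 (e / norm (q - p))"
  define r where "r = p + d *\<^sub>R (q - p)"
  have d: "0 < d" "d \<le> 1" "d * norm (q - p) \<le> e"
    using e assms(2) by (auto simp: d_def min_def field_simps)
  have r_pq: "r \<in> closed_segment p q"
    unfolding r_def in_segment using d by (intro exI[of _ d]) (auto simp: algebra_simps)
  have r_e: "r \<in> cball p e"
    using d by (simp add: r_def dist_norm)
  have "closed_segment p r \<subseteq> closed_segment p q"
    using r_pq by (simp add: subset_closed_segment)
  moreover have "closed_segment p r \<subseteq> cball p e"
    using r_e e by (intro closed_segment_subset) auto
  ultimately have pr: "closed_segment p r \<subseteq> frontier K \<inter> U" "closed_segment p r \<subseteq> closed_segment p q"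
    using e assms(4) by auto
  have "p \<noteq> r" using d assms(2) by (simp add: r_def)
  \<comment> \<open>The chart coordinates of \<open>[p, r]\<close> form a connected set with two points, so they contain an open interval.\<close>
  define J where "J = g ` closed_segment p r"
  have cg: "c (g z) = z" if "z \<in> closed_segment p r" for z
    using hom pr that unfolding homeomorphism_def by blast
  have J: "J \<subseteq> {-1<..<1}" "connected J"
  proof -
    have g: "g ` (frontier K \<inter> U) = {-1<..<1}" "continuous_on (frontier K \<inter> U) g"
      using hom by (simp_all add: homeomorphism_def)
    show "J \<subseteq> {-1<..<1}"
      unfolding J_def g(1)[symmetric] using pr(1) by (rule image_mono)
    show "connected J"
      unfolding J_def
      by (rule connected_continuous_image[OF continuous_on_subset[OF g(2) pr(1)] connected_segment(1)])
  qed
  have "g p \<noteq> g r" using cg \<open>p \<noteq> r\<close> by (metis ends_in_segment)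
  then obtain t0 t1 where t01: "t0 < t1" "t0 \<in> J" "t1 \<in> J"
    unfolding J_def by (metis ends_in_segment imageI linorder_neqE)
  then have sub: "{t0<..<t1} \<subseteq> J"
    using connected_contains_Icc[OF J(2) t01(2,3)] by auto
  define t where "t = (t0 + t1) / 2"
  have t: "t \<in> {t0<..<t1}" using t01 by (simp add: t_def)
  have const: "u \<bullet> c v = b" if v: "v \<in> {t0<..<t1}" for v
  proof -
    obtain z where z: "z \<in> closed_segment p r" "v = g z"
      using sub v unfolding J_def by blast
    then show ?thesis
      using cg flat pr(2) by auto
  qed
  have in_dom: "v \<in> {-1<..<1}" if "v \<in> {t0<..<t1}" for v
    using that sub J(1) by blast
  have D1: "(c has_vector_derivative vel c v) (at v)"
    and D2: "(vel c has_vector_derivative vel (vel c) v) (at v)" if "v \<in> {t0<..<t1}" for v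
    using reg in_dom[OF that]
    unfolding regular_C2_on_def C1_differentiable_on_eq vector_derivative_works[symmetric] by blast+
  have zero: "D = 0"
    if "(f has_vector_derivative D') (at v)" "D = u \<bullet> D'" "v \<in> {t0<..<t1}" "\<And>w. w \<in> {t0<..<t1} \<Longrightarrow> u \<bullet> f w = k"
    for f :: "real \<Rightarrow> real^2" and D D' v k
  proof -
    have "((\<lambda>w. u \<bullet> f w) has_vector_derivative D) (at v)"
      using bounded_linear.has_vector_derivative[OF bounded_linear_inner_right that(1), of u] that(2) by simp
    then have "((\<lambda>w. k) has_vector_derivative D) (at v)"
      by (rule has_vector_derivative_transform_within_open[where S="{t0<..<t1}"]) (use that in auto)
    then show ?thesis
      using vector_derivative_unique_at has_vector_derivative_const by blast
  qed
  have u1: "u \<bullet> vel c v = 0" if "v \<in> {t0<..<t1}" for v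
    by (rule zero[OF D1[OF that] refl that const])
  have u2: "u \<bullet> vel (vel c) t = 0"
    by (rule zero[OF D2[OF t] refl t u1])
  have "det (vector [vel c t, vel (vel c) t] :: real^2^2) = 0"
  proof -
    define v w where "v = vel c t" and "w = vel (vel c) t"
    have v: "u$1 * v$1 + u$2 * v$2 = 0" and w: "u$1 * w$1 + u$2 * w$2 = 0"
      using u1[OF t] u2 by (simp_all add: v_def w_def inner_vec_def sum_2)
    have "u$1 * (v$1 * w$2 - v$2 * w$1) = 0"
      using v w by algebra
    moreover have "u$2 * (v$1 * w$2 - v$2 * w$1) = 0"
      using v w by algebra
    moreover have "u$1 \<noteq> 0 \<or> u$2 \<noteq> 0"
      using assms(3) by (simp add: vec_eq_iff forall_2)
    ultimately have "v$1 * w$2 - v$2 * w$1 = 0" by auto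
    then show ?thesis by (simp add: det_2 vector_2 v_def w_def)
  qed
  then have "curvature c t = 0" by (simp add: curvature_def)
  then show False using curv in_dom[OF t] by force
qed

definition support_point :: "(real^2) set \<Rightarrow> real \<Rightarrow> real^2" where
  "support_point K \<theta> = (SOME p. p \<in> K \<and> (\<forall>y\<in>K. nvec \<theta> \<bullet> y \<le> nvec \<theta> \<bullet> p))"

lemma
  assumes "convex_body K"
  shows support_point_in: "support_point K \<theta> \<in> K"
    and support_point_max: "y \<in> K \<Longrightarrow> nvec \<theta> \<bullet> y \<le> nvec \<theta> \<bullet> support_point K \<theta>"
proof -
  have "compact K" "K \<noteq> {}"
    using assms by (auto simp: convex_body_def)
  then have "\<exists>p\<in>K. \<forall>y\<in>K. nvec \<theta> \<bullet> y \<le> nvec \<theta> \<bullet> p"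
    by (intro continuous_attains_sup continuous_intros)
  then have "\<exists>p. p \<in> K \<and> (\<forall>y\<in>K. nvec \<theta> \<bullet> y \<le> nvec \<theta> \<bullet> p)"
    by blast
  then have "support_point K \<theta> \<in> K \<and> (\<forall>y\<in>K. nvec \<theta> \<bullet> y \<le> nvec \<theta> \<bullet> support_point K \<theta>)"
    unfolding support_point_def by (rule someI_ex)
  then show "support_point K \<theta> \<in> K" "y \<in> K \<Longrightarrow> nvec \<theta> \<bullet> y \<le> nvec \<theta> \<bullet> support_point K \<theta>"
    by auto
qed

lemma support_fun_eq:
  assumes "convex_body K"
  shows "support_fun K \<theta> = nvec \<theta> \<bullet> support_point K \<theta>"
  unfolding support_fun_def
  by (rule cSup_eq_maximum) (use support_point_in[OF assms] support_point_max[OF assms] in auto)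

lemma support_point_unique:
  assumes K: "convex_body K" "C2_plus K"
    and p: "p \<in> K" "\<forall>y\<in>K. nvec \<theta> \<bullet> y \<le> nvec \<theta> \<bullet> p"
  shows "support_point K \<theta> = p"
proof (rule ccontr)
  define q where "q = support_point K \<theta>"
  define b where "b = nvec \<theta> \<bullet> p"
  assume "support_point K \<theta> \<noteq> p"
  then have ne: "q \<noteq> p" by (simp add: q_def)
  have q: "q \<in> K" "nvec \<theta> \<bullet> q = b"
    using support_point_in[OF K(1)] support_point_max[OF K(1) p(1)] p(2)
    by (auto simp: q_def b_def intro: antisym)
  have seg: "closed_segment q p \<subseteq> K"
    using K(1) p q by (intro closed_segment_subset) (auto simp: convex_body_def)
  have flat: "nvec \<theta> \<bullet> z = b" if z: "z \<in> closed_segment q p" for z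
  proof -
    obtain l where "z = (1 - l) *\<^sub>R q + l *\<^sub>R p"
      using z unfolding in_segment by blast
    then have "nvec \<theta> \<bullet> z = (1 - l) * b + l * b"
      using q(2) by (simp add: b_def inner_add_right)
    then show ?thesis by (simp add: algebra_simps)
  qed
  have "nvec \<theta> \<noteq> 0" using norm_nvec[of \<theta>] by force
  have "z \<in> frontier K" if z: "z \<in> closed_segment q p" for z
  proof -
    have "z \<notin> interior K"
      using interior_less_support[OF _ \<open>nvec \<theta> \<noteq> 0\<close>, of z K b] p(2) flat[OF z] by (auto simp: b_def)
    then show ?thesis
      using seg z closure_subset[of K] by (auto simp: frontier_def)
  qed
  then have "closed_segment q p \<subseteq> frontier K" by blast
  then show False
    using C2_plus_no_segment[OF K(2) ne \<open>nvec \<theta> \<noteq> 0\<close>] flat by blast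
qed

text \<open>
  By uniqueness, the graph is cut out by the closed conditions \<open>p \<in> K\<close> and
  \<open>\<langle>n\<^sub>\<theta>, y\<rangle> \<le> \<langle>n\<^sub>\<theta>, p\<rangle>\<close> for \<open>y \<in> K\<close>, and a map into a compact set with closed graph is continuous.
\<close>

lemma continuous_support_point:
  assumes K: "convex_body K" "C2_plus K"
  shows "continuous_on UNIV (support_point K)"
proof (rule continuous_from_closed_graph)
  show "compact K" using K by (simp add: convex_body_def)
  show "support_point K \<in> UNIV \<rightarrow> K" using support_point_in[OF K(1)] by auto
  have "(\<lambda>\<theta>. (\<theta>, support_point K \<theta>)) ` UNIV =
      {z. snd z \<in> K} \<inter> (\<Inter>y\<in>K. {z. nvec (fst z) \<bullet> y \<le> nvec (fst z) \<bullet> snd z})"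
    using support_point_unique[OF K] support_point_in[OF K(1)] support_point_max[OF K(1)]
    by (auto simp: image_iff)
  moreover have "closed {z :: real \<times> (real^2). snd z \<in> K}"
    using K closed_vimage_snd[of K] by (simp add: convex_body_def compact_imp_closed vimage_def)
  moreover have "closed {z :: real \<times> (real^2). nvec (fst z) \<bullet> y \<le> nvec (fst z) \<bullet> snd z}" for y
    by (intro closed_Collect_le continuous_intros
        continuous_on_compose2[OF continuous_on_nvec[of UNIV]]) auto
  ultimately show "closed ((\<lambda>\<theta>. (\<theta>, support_point K \<theta>)) ` UNIV)"
    by (simp only:) (intro closed_Int closed_INT ballI)
qed

text \<open>
  The envelope argument: \<open>h \<eta>\<close> exceeds \<open>\<langle>n\<^sub>\<eta>, p \<theta>\<rangle>\<close> by at most \<open>\<bar>\<eta> - \<theta>\<bar> \<cdot> \<parallel>p \<eta> - p \<theta>\<parallel>\<close>, so the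
  moving of the support point contributes nothing to the derivative.
\<close>

lemma support_fun_DERIV:
  assumes K: "convex_body K" "C2_plus K"
  shows "(support_fun K has_real_derivative tvec \<theta> \<bullet> support_point K \<theta>) (at \<theta>)"
proof -
  let ?p = "support_point K"
  let ?A = "\<lambda>\<eta>. (support_fun K \<eta> - support_fun K \<theta>) / (\<eta> - \<theta>)"
  let ?B = "\<lambda>\<eta>. (nvec \<eta> \<bullet> ?p \<theta> - nvec \<theta> \<bullet> ?p \<theta>) / (\<eta> - \<theta>)"
  have bound: "norm (?A \<eta> - ?B \<eta>) \<le> norm (?p \<eta> - ?p \<theta>)" if "\<eta> \<noteq> \<theta>" for \<eta>
  proof -
    have "0 \<le> support_fun K \<eta> - nvec \<eta> \<bullet> ?p \<theta>"
      using support_point_max[OF K(1) support_point_in[OF K(1)]] by (simp add: support_fun_eq[OF K(1)])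
    moreover have "support_fun K \<eta> - nvec \<eta> \<bullet> ?p \<theta> \<le> norm (?p \<eta> - ?p \<theta>) * \<bar>\<eta> - \<theta>\<bar>"
      using nvec_Lipschitz[of \<eta> "?p \<eta> - ?p \<theta>" \<theta>]
        support_point_max[OF K(1) support_point_in[OF K(1)], of \<theta> \<eta>]
      by (simp add: support_fun_eq[OF K(1)] inner_diff_right)
    ultimately have "\<bar>support_fun K \<eta> - nvec \<eta> \<bullet> ?p \<theta>\<bar> / \<bar>\<eta> - \<theta>\<bar> \<le> norm (?p \<eta> - ?p \<theta>)"
      using that by (simp add: divide_simps)
    moreover have "?A \<eta> - ?B \<eta> = (support_fun K \<eta> - nvec \<eta> \<bullet> ?p \<theta>) / (\<eta> - \<theta>)"
      by (simp add: support_fun_eq[OF K(1)] diff_divide_distrib)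
    ultimately show ?thesis by simp
  qed
  have "(?p \<longlongrightarrow> ?p \<theta>) (at \<theta>)"
    using continuous_support_point[OF K] by (simp add: continuous_on_def)
  then have "((\<lambda>\<eta>. norm (?p \<eta> - ?p \<theta>)) \<longlongrightarrow> 0) (at \<theta>)"
    by (intro tendsto_norm_zero) (simp add: LIM_zero_iff)
  then have "((\<lambda>\<eta>. ?A \<eta> - ?B \<eta>) \<longlongrightarrow> 0) (at \<theta>)"
    by (rule Lim_null_comparison[rotated])
      (simp only: eventually_at_filter, intro always_eventually allI impI bound)
  moreover have "(?B \<longlongrightarrow> tvec \<theta> \<bullet> ?p \<theta>) (at \<theta>)"
    using DERIV_inner_nvec[of "?p \<theta>" \<theta> UNIV] by (simp add: has_field_derivative_iff)
  ultimately show ?thesis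
    unfolding has_field_derivative_iff by (drule_tac tendsto_add) auto
qed

lemma continuous_support_fun:
  assumes "convex_body K" "C2_plus K"
  shows "continuous_on S (support_fun K)"
  by (meson DERIV_isCont assms continuous_at_imp_continuous_on support_fun_DERIV)

section \<open>A function with quadratically small increments\<close>

text \<open>
  Reparametrized by the value of \<open>g\<close>, the function \<open>F\<close> has increments quadratic in those of the
  argument, so its derivative is zero.
\<close>

lemma constant_of_quadratic_increments:
  fixes F g :: "real \<Rightarrow> real"
  assumes "a \<le> b" and cont: "continuous_on {a..b} g" and mono: "strict_mono_on {a..b} g"
    and quad: "\<And>s t. a \<le> s \<Longrightarrow> s \<le> t \<Longrightarrow> t \<le> b \<Longrightarrow> \<bar>F t - F s\<bar> \<le> C * (g t - g s)\<^sup>2"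
  shows "F b = F a"
proof -
  define k where "k = inv_into {a..b} g"
  have inj: "inj_on g {a..b}" using mono by (rule strict_mono_on_imp_inj_on)
  have img: "{g a..g b} \<subseteq> g ` {a..b}"
    using IVT'[of g a _ b] assms(1) cont by fastforce
  have k: "k u \<in> {a..b}" "g (k u) = u" if "u \<in> {g a..g b}" for u
    using that img by (auto simp: k_def inv_into_into f_inv_into_f subset_iff simp del: atLeastAtMost_iff)
  have kg: "k (g s) = s" if "s \<in> {a..b}" for s
    using that inj by (simp add: k_def)
  have bound: "\<bar>F (k v) - F (k u)\<bar> \<le> C * (v - u)\<^sup>2" if "u \<in> {g a..g b}" "v \<in> {g a..g b}" for u v
    using quad[of "k u" "k v"] quad[of "k v" "k u"] k[OF that(1)] k[OF that(2)]
    by (cases "k u \<le> k v") (auto simp: abs_minus_commute power2_commute)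
  have "((\<lambda>u. F (k u)) has_real_derivative 0) (at u within {g a..g b})" if u: "u \<in> {g a..g b}" for u
  proof -
    have "((\<lambda>v. C * \<bar>v - u\<bar>) \<longlongrightarrow> C * \<bar>u - u\<bar>) (at u within {g a..g b})"
      by (intro tendsto_intros)
    then have "((\<lambda>v. C * \<bar>v - u\<bar>) \<longlongrightarrow> 0) (at u within {g a..g b})" by simp
    moreover have "\<forall>\<^sub>F v in at u within {g a..g b}. norm ((F (k v) - F (k u)) / (v - u)) \<le> C * \<bar>v - u\<bar>"
      unfolding eventually_at_filter
    proof (intro always_eventually allI impI)
      fix v assume v: "v \<noteq> u" "v \<in> {g a..g b}"
      have "\<bar>F (k v) - F (k u)\<bar> \<le> C * \<bar>v - u\<bar> * \<bar>v - u\<bar>"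
        using bound[OF u v(2)] by (simp add: power2_eq_square abs_mult_self_eq mult.assoc)
      then show "norm ((F (k v) - F (k u)) / (v - u)) \<le> C * \<bar>v - u\<bar>"
        using v by (simp add: divide_simps)
    qed
    ultimately show ?thesis
      unfolding has_field_derivative_iff by (rule Lim_null_comparison[rotated])
  qed
  then obtain c where c: "\<And>u. u \<in> {g a..g b} \<Longrightarrow> F (k u) = c"
    using has_field_derivative_zero_constant[of "{g a..g b}" "\<lambda>u. F (k u)"] by auto
  have "g a \<le> g b"
    using mono assms(1) by (metis atLeastAtMost_iff order_refl order_le_less strict_mono_onD)
  then have "F (k (g a)) = F (k (g b))" using c by simp
  then show ?thesis using kg assms(1) by simp
qed

section \<open>Boundary curves with a continuous normal angle\<close>

text \<open>
  The sign \<open>\<sigma>\<close> is the orientation, \<open>1\<close> for counterclockwise and \<open>- 1\<close> for clockwise. It lets both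
  involutes be treated at once, with \<open>\<sigma> * \<phi>\<close> in the role of an increasing angle.
\<close>

locale boundary_curve =
  fixes K :: "(real^2) set" and x :: "real \<Rightarrow> real^2" and s0 L \<sigma> :: real and \<phi> :: "real \<Rightarrow> real"
  assumes body: "convex_body K" "C2_plus K"
    and sign: "\<sigma> = 1 \<or> \<sigma> = - 1"
    and period: "L > 0" "\<And>s. x (s + L) = x s"
    and angle_continuous: "continuous_on {s0..} \<phi>"
    and normal: "\<And>s. s \<ge> s0 \<Longrightarrow> outer_unit_normal K (x s) (nvec (\<phi> s))"
    and velocity: "\<And>s. s \<ge> s0 \<Longrightarrow> (x has_vector_derivative \<sigma> *\<^sub>R tvec (\<phi> s)) (at s)"
begin

lemma sigma_square: "\<sigma> * \<sigma> = 1" using sign by auto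

lemma support_point_eq: "s \<ge> s0 \<Longrightarrow> support_point K (\<phi> s) = x s"
proof -
  assume "s \<ge> s0"
  note n = normal[OF this]
  have "closed K" using body(1) by (simp add: convex_body_def compact_imp_closed)
  then have "x s \<in> K"
    using n frontier_subset_closed unfolding outer_unit_normal_def by blast
  then show ?thesis
    using n support_point_unique[OF body] unfolding outer_unit_normal_def by blast
qed

lemma DERIV_inner_curve:
  assumes "s \<ge> s0"
  shows "((\<lambda>u. w \<bullet> x u) has_real_derivative \<sigma> * (w \<bullet> tvec (\<phi> s))) (at s within S)"
  using bounded_linear.has_vector_derivative[OF bounded_linear_inner_right velocity[OF assms], of w]
  by (auto simp: has_real_derivative_iff_has_vector_derivative intro: has_vector_derivative_at_within)

lemma sin_sigma: "\<sigma> * sin y = sin (\<sigma> * y)"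
  using sign by auto

text \<open>
  If \<open>\<sigma> \<phi>\<close> failed to increase strictly on \<open>{a..b}\<close>, it would have a maximum point \<open>c < b\<close>. Right of
  \<open>c\<close> the height \<open>\<langle>n, x\<rangle>\<close> in the normal direction at \<open>c\<close> has derivative
  \<open>sin (\<sigma> (\<phi> c - \<phi> u)) \<ge> 0\<close>, although \<open>x c\<close> already has the maximal height. So a later point of
  the curve is a second support point in this direction, different from \<open>x c\<close> because the curve
  advances along the tangent at \<open>c\<close>.
\<close>

lemma angle_strict_mono:
  assumes "s0 \<le> a" "a < b"
  shows "\<sigma> * \<phi> a < \<sigma> * \<phi> b"
proof (rule ccontr)
  assume "\<not> ?thesis"
  then have ab: "\<sigma> * \<phi> b \<le> \<sigma> * \<phi> a" by simp
  have cont: "continuous_on {a..b} (\<lambda>s. \<sigma> * \<phi> s)"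
    using assms by (intro continuous_intros continuous_on_subset[OF angle_continuous]) auto
  then obtain m where m: "m \<in> {a..b}" "\<forall>u\<in>{a..b}. \<sigma> * \<phi> u \<le> \<sigma> * \<phi> m"
    using continuous_attains_sup[of "{a..b}" "\<lambda>s. \<sigma> * \<phi> s"] assms by auto
  \<comment> \<open>If the maximum is at \<open>b\<close>, then the failing inequality makes \<open>a\<close> a maximum point as well.\<close>
  define c where "c = (if m = b then a else m)"
  have c: "a \<le> c" "c < b" "\<forall>u\<in>{a..b}. \<sigma> * \<phi> u \<le> \<sigma> * \<phi> c"
    using m assms ab by (auto simp: c_def split: if_splits)
  then have cs: "s0 \<le> c" using assms by simp
  have "\<exists>d>0. \<forall>u\<in>{a..b}. dist u c < d \<longrightarrow> dist (\<sigma> * \<phi> u) (\<sigma> * \<phi> c) < pi/2"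
    using cont c unfolding continuous_on_iff by (metis atLeastAtMost_iff less_eq_real_def pi_half_gt_zero)
  then obtain d where d: "d > 0" "\<And>u. u \<in> {a..b} \<Longrightarrow> dist u c < d \<Longrightarrow> dist (\<sigma> * \<phi> u) (\<sigma> * \<phi> c) < pi/2"
    by blast
  define e where "e = min b (c + d/2)"
  have e: "c < e" "e \<le> b" "e < c + d" using c d by (auto simp: e_def min_def)
  have near: "0 \<le> \<sigma> * (\<phi> c - \<phi> u)" "\<sigma> * (\<phi> c - \<phi> u) < pi/2" if "c \<le> u" "u \<le> e" for u
    using d(2)[of u] c e that by (auto simp: dist_real_def algebra_simps abs_if split: if_splits)
  have "nvec (\<phi> c) \<bullet> x c \<le> nvec (\<phi> c) \<bullet> x e"
  proof (rule DERIV_nonneg_imp_nondecreasing[where f="\<lambda>u. nvec (\<phi> c) \<bullet> x u"])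
    show "c \<le> e" using e by simp
    fix u assume u: "c \<le> u" "u \<le> e"
    have "0 \<le> \<sigma> * (nvec (\<phi> c) \<bullet> tvec (\<phi> u))"
      using near[OF u] by (simp add: nvec_inner_tvec sin_sigma sin_ge_zero)
    then show "\<exists>y. ((\<lambda>u. nvec (\<phi> c) \<bullet> x u) has_real_derivative y) (at u) \<and> 0 \<le> y"
      using DERIV_inner_curve[of u "nvec (\<phi> c)" UNIV] u cs by (meson order_trans)
  qed
  moreover have "x e \<in> K" 
    using support_point_eq[of e] support_point_in[OF body(1)] e cs by (metis less_imp_le order_trans)
  moreover have "x c = support_point K (\<phi> c)" using support_point_eq[OF cs] by simp
  ultimately have "x e = x c"
    using support_point_unique[OF body, of "x e" "\<phi> c"] support_point_max[OF body(1), of _ "\<phi> c"]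
    by (metis order_trans)
  moreover have "\<sigma> * (tvec (\<phi> c) \<bullet> x c) < \<sigma> * (tvec (\<phi> c) \<bullet> x e)"
  proof (rule DERIV_pos_imp_increasing[where f="\<lambda>u. \<sigma> * (tvec (\<phi> c) \<bullet> x u)"])
    show "c < e" by fact
    fix u assume u: "c \<le> u" "u \<le> e"
    have "cos (\<sigma> * (\<phi> c - \<phi> u)) > 0"
      using near[OF u] by (intro cos_gt_zero_pi) auto
    then have "cos (\<phi> c - \<phi> u) > 0"
      using sign by (auto simp: cos_minus[of "\<phi> c - \<phi> u", simplified])
    moreover have "((\<lambda>u. \<sigma> * (tvec (\<phi> c) \<bullet> x u)) has_real_derivative cos (\<phi> c - \<phi> u)) (at u)"
      using DERIV_cmult[OF DERIV_inner_curve[of u "tvec (\<phi> c)" UNIV], of \<sigma>] u cs sigma_square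
      by (simp add: tvec_inner_tvec mult.assoc[symmetric])
    ultimately show "\<exists>y. ((\<lambda>u. \<sigma> * (tvec (\<phi> c) \<bullet> x u)) has_real_derivative y) (at u) \<and> 0 < y"
      by blast
  qed
  ultimately show False by simp
qed

text \<open>
  After a period the velocity, hence the angle modulo a full turn, is the same, and the angle has
  strictly increased.
\<close>

lemma angle_advance:
  assumes "s0 \<le> s"
  shows "\<sigma> * \<phi> s + 2 * pi \<le> \<sigma> * \<phi> (s + L)"
proof -
  have "((\<lambda>u. x (u + L)) has_vector_derivative \<sigma> *\<^sub>R tvec (\<phi> (s + L))) (at s)"
  proof -
    have "((\<lambda>u. u + L) has_vector_derivative 1) (at s)"
      by (auto intro!: derivative_eq_intros)
    from vector_diff_chain_at[OF this velocity[of "s + L"]] show ?thesis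
      using assms period(1) by (simp add: o_def)
  qed
  then have "\<sigma> *\<^sub>R tvec (\<phi> (s + L)) = \<sigma> *\<^sub>R tvec (\<phi> s)"
    using vector_derivative_unique_at[OF _ velocity[OF assms]] by (simp only: period(2))
  then have "tvec (\<phi> (s + L)) = tvec (\<phi> s)"
    using sign by auto
  then have "sin (\<phi> (s + L)) = sin (\<phi> s) \<and> cos (\<phi> (s + L)) = cos (\<phi> s)"
    unfolding tvec_def by (metis minus_minus vector_2)
  then obtain n :: int where n: "\<phi> (s + L) = \<phi> s + 2 * pi * n"
    using sin_cos_eq_iff by metis
  define k :: int where "k = (if \<sigma> = 1 then n else - n)"
  have k: "\<sigma> * \<phi> (s + L) = \<sigma> * \<phi> s + 2 * pi * k"
    using sign n by (auto simp: k_def)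
  then have "2 * pi * k > 0"
    using angle_strict_mono[OF assms, of "s + L"] period(1) by simp
  then have "k > 0" by (simp add: zero_less_mult_iff)
  then have "2 * pi * 1 \<le> 2 * pi * real_of_int k"
    by (intro mult_left_mono) auto
  then show ?thesis using k by simp
qed

lemma angle_surj:
  assumes "\<sigma> * \<phi> s0 \<le> \<sigma> * \<alpha>"
  shows "\<exists>s\<ge>s0. \<phi> s = \<alpha>"
proof -
  have advance: "\<sigma> * \<phi> s0 + 2 * pi * real n \<le> \<sigma> * \<phi> (s0 + real n * L)" for n
  proof (induction n)
    case (Suc n)
    have "s0 \<le> s0 + real n * L" using period(1) by simp
    from angle_advance[OF this] Suc show ?case
      by (simp add: algebra_simps)
  qed simp
  obtain n where n: "(\<sigma> * \<alpha> - \<sigma> * \<phi> s0) / (2 * pi) \<le> real n"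
    using real_arch_simple by blast
  then have "\<sigma> * \<alpha> \<le> \<sigma> * \<phi> (s0 + real n * L)"
    using advance[of n] by (simp add: divide_simps mult.commute)
  moreover have "continuous_on {s0..s0 + real n * L} (\<lambda>s. \<sigma> * \<phi> s)"
    by (intro continuous_intros continuous_on_subset[OF angle_continuous]) auto
  ultimately obtain s where "s \<ge> s0" "\<sigma> * \<phi> s = \<sigma> * \<alpha>"
    using IVT'[of "\<lambda>s. \<sigma> * \<phi> s" s0 "\<sigma> * \<alpha>" "s0 + real n * L"] assms period(1) by auto
  then show ?thesis using sign by auto
qed

text \<open>
  For parameters \<open>s \<le> t\<close> at angular distance \<open>\<delta>\<close>, pass from \<open>s\<close> to \<open>t\<close> in two stages. Turning the
  frame while \<open>x s\<close> stays fixed changes \<open>\<langle>t\<^sub>\<alpha>, x s\<rangle> + H \<alpha>\<close> at the rate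
  \<open>h \<alpha> - \<langle>n\<^sub>\<alpha>, x s\<rangle>\<close>, which vanishes at the starting angle and is \<open>O(\<delta>)\<close> throughout. Moving the
  point while the frame stays fixed changes \<open>\<langle>t, x u\<rangle> - \<sigma> u\<close> at the rate
  \<open>\<sigma> (cos (\<phi> t - \<phi> u) - 1)\<close>, which is also \<open>O(\<delta>)\<close>.
\<close>

lemma arc_length_formula:
  assumes H: "\<And>\<alpha>. (H has_real_derivative support_fun K \<alpha>) (at \<alpha>)" and "s0 \<le> b"
  shows "tvec (\<phi> b) \<bullet> x b + H (\<phi> b) - \<sigma> * (b - s0) = tvec (\<phi> s0) \<bullet> x s0 + H (\<phi> s0)"
proof -
  define F where "F = (\<lambda>s. tvec (\<phi> s) \<bullet> x s + H (\<phi> s) - \<sigma> * (s - s0))"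
  define g where "g = (\<lambda>s. s + \<sigma> * \<phi> s)"
  have "bounded K" using body(1) by (simp add: convex_body_def compact_imp_bounded)
  then obtain D where D: "\<And>y z. y \<in> K \<Longrightarrow> z \<in> K \<Longrightarrow> norm (y - z) \<le> D"
    unfolding bounded_two_points dist_norm by blast
  have D0: "D \<ge> 0"
    using D[OF support_point_in support_point_in, OF body(1) body(1)] norm_ge_zero order_trans by blast
  have gmono: "strict_mono_on {s0..b} g"
    using angle_strict_mono by (auto simp: g_def strict_mono_on_def intro: add_strict_mono)
  have "F b = F s0"
  proof (rule constant_of_quadratic_increments[OF assms(2) _ gmono])
    show "continuous_on {s0..b} g"
      unfolding g_def by (intro continuous_intros continuous_on_subset[OF angle_continuous]) auto
    fix s t assume st: "s0 \<le> s" "s \<le> t" "t \<le> b"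
    then have t0: "s0 \<le> t" by simp
    define \<delta> where "\<delta> = \<sigma> * (\<phi> t - \<phi> s)"
    have mono_le: "\<sigma> * \<phi> u \<le> \<sigma> * \<phi> v" if "s0 \<le> u" "u \<le> v" for u v
      using angle_strict_mono[of u v] that by (cases "u = v") auto
    have \<delta>: "0 \<le> \<delta>" "\<bar>\<phi> t - \<phi> s\<bar> = \<delta>"
      using mono_le[OF st(1,2)] sign by (auto simp: \<delta>_def algebra_simps)
    have "\<bar>(tvec (\<phi> t) \<bullet> x t - \<sigma> * t) - (tvec (\<phi> t) \<bullet> x s - \<sigma> * s)\<bar> \<le> \<delta> * \<bar>t - s\<bar>"
    proof -
      have "norm (\<sigma> * (tvec (\<phi> t) \<bullet> tvec (\<phi> u)) - \<sigma>) \<le> \<delta>" if "u \<in> {s..t}" for u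
      proof -
        have "\<bar>cos (\<phi> t - \<phi> u) - cos 0\<bar> \<le> \<bar>\<phi> t - \<phi> u\<bar>"
          using nvec_Lipschitz[of "\<phi> t - \<phi> u" "nvec 0" 0] by (simp add: nvec_inner_nvec)
        also have "\<dots> \<le> \<delta>"
          using mono_le[of u t] mono_le[of s u] that st sign by (auto simp: \<delta>_def)
        finally show ?thesis
          using sign by (auto simp: tvec_inner_tvec)
      qed
      moreover have "((\<lambda>u. tvec (\<phi> t) \<bullet> x u - \<sigma> * u) has_real_derivative
          \<sigma> * (tvec (\<phi> t) \<bullet> tvec (\<phi> u)) - \<sigma>) (at u within {s..t})" if "u \<in> {s..t}" for u
        using that st by (auto intro!: derivative_eq_intros DERIV_inner_curve)
      ultimately show ?thesis
        using field_differentiable_bound[of "{s..t}" "\<lambda>u. tvec (\<phi> t) \<bullet> x u - \<sigma> * u"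
            "\<lambda>u. \<sigma> * (tvec (\<phi> t) \<bullet> tvec (\<phi> u)) - \<sigma>" \<delta> t s] st by auto
    qed
    moreover have "\<bar>(tvec (\<phi> t) \<bullet> x s + H (\<phi> t)) - (tvec (\<phi> s) \<bullet> x s + H (\<phi> s))\<bar> \<le> (D * \<delta>) * \<delta>"
    proof -
      let ?I = "closed_segment (\<phi> s) (\<phi> t)"
      have "((\<lambda>\<alpha>. tvec \<alpha> \<bullet> x s + H \<alpha>) has_real_derivative - (nvec \<alpha> \<bullet> x s) + support_fun K \<alpha>) (at \<alpha> within ?I)" for \<alpha>
        by (intro DERIV_add DERIV_inner_tvec has_field_derivative_at_within[OF H])
      moreover have "norm (- (nvec \<alpha> \<bullet> x s) + support_fun K \<alpha>) \<le> D * \<delta>" if "\<alpha> \<in> ?I" for \<alpha>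
      proof -
        let ?p = "support_point K \<alpha>"
        have xs: "x s \<in> K" "x s = support_point K (\<phi> s)"
          using support_point_eq[OF st(1)] support_point_in[OF body(1)] by metis+
        have p: "?p \<in> K" using support_point_in[OF body(1)] .
        have "0 \<le> nvec \<alpha> \<bullet> (?p - x s)"
          using support_point_max[OF body(1) xs(1)] by (simp add: inner_diff_right)
        moreover have "nvec (\<phi> s) \<bullet> (?p - x s) \<le> 0"
          using support_point_max[OF body(1) p] xs(2) by (simp add: inner_diff_right)
        moreover have "nvec \<alpha> \<bullet> (?p - x s) - nvec (\<phi> s) \<bullet> (?p - x s) \<le> norm (?p - x s) * \<bar>\<alpha> - \<phi> s\<bar>"
          using nvec_Lipschitz[of \<alpha> "?p - x s" "\<phi> s"] by linarith
        moreover have "norm (?p - x s) * \<bar>\<alpha> - \<phi> s\<bar> \<le> D * \<delta>"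
        proof (intro mult_mono D p xs D0)
          show "\<bar>\<alpha> - \<phi> s\<bar> \<le> \<delta>"
            using segment_bound(1)[OF that] \<delta>(2) by simp
        qed auto
        ultimately show ?thesis
          by (simp add: support_fun_eq[OF body(1)] inner_diff_right)
      qed
      ultimately show ?thesis
        using field_differentiable_bound[of ?I "\<lambda>\<alpha>. tvec \<alpha> \<bullet> x s + H \<alpha>"
            "\<lambda>\<alpha>. - (nvec \<alpha> \<bullet> x s) + support_fun K \<alpha>" "D * \<delta>" "\<phi> t" "\<phi> s"] \<delta>(2) by auto
    qed
    moreover have "F t - F s = ((tvec (\<phi> t) \<bullet> x t - \<sigma> * t) - (tvec (\<phi> t) \<bullet> x s - \<sigma> * s)) +
        ((tvec (\<phi> t) \<bullet> x s + H (\<phi> t)) - (tvec (\<phi> s) \<bullet> x s + H (\<phi> s)))"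
      by (simp add: F_def algebra_simps)
    moreover have "\<delta> * \<bar>t - s\<bar> = \<delta> * (t - s)"
      using st(2) by simp
    ultimately have "\<bar>F t - F s\<bar> \<le> \<delta> * (t - s) + D * \<delta> * \<delta>"
      by linarith
    also have "\<dots> \<le> (1 + D) * (g t - g s)\<^sup>2"
    proof -
      have g: "g t - g s = (t - s) + \<delta>" by (simp add: g_def \<delta>_def algebra_simps)
      have "\<delta> * (t - s) \<le> (g t - g s)\<^sup>2" "\<delta> * \<delta> \<le> (g t - g s)\<^sup>2"
        unfolding g power2_eq_square using \<delta>(1) st by (intro mult_mono; simp)+
      then have "\<delta> * (t - s) + D * (\<delta> * \<delta>) \<le> (g t - g s)\<^sup>2 + D * (g t - g s)\<^sup>2"
        using D0 by (intro add_mono mult_left_mono)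
      then show ?thesis by (simp add: algebra_simps)
    qed
    finally show "\<bar>F t - F s\<bar> \<le> (1 + D) * (g t - g s)\<^sup>2" .
  qed
  then show ?thesis by (simp add: F_def)
qed

lemma angle_inj: "inj_on \<phi> {s0..}"
proof (rule linorder_inj_onI)
  show "\<phi> s \<noteq> \<phi> t" if "s < t" "s \<in> {s0..}" for s t
    using angle_strict_mono[of s t] that by auto
qed auto

lemma angle_involute_formula:
  assumes "\<sigma> * \<phi> s0 \<le> \<sigma> * \<alpha>"
  shows "angle_involute x s0 \<phi> \<alpha> = support_fun K \<alpha> *\<^sub>R nvec \<alpha> -
    ((LBINT \<tau>=ereal (\<phi> s0)..ereal \<alpha>. support_fun K \<tau>) - deriv (support_fun K) (\<phi> s0)) *\<^sub>R tvec \<alpha>"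
proof -
  obtain s where s: "s \<ge> s0" "\<phi> s = \<alpha>" using angle_surj[OF assms] by blast
  then have inv: "inv_into {s0..} \<phi> \<alpha> = s"
    using inv_into_f_f[OF angle_inj, of s] by simp
  define H where "H = (\<lambda>\<alpha>. LBINT \<tau>=ereal (\<phi> s0)..ereal \<alpha>. support_fun K \<tau>)"
  have "(H has_real_derivative support_fun K \<beta>) (at \<beta>)" for \<beta>
  proof -
    \<comment> \<open>An interval with both \<open>\<phi> s0\<close> and \<open>\<beta>\<close> in its interior, so that the derivative is two-sided.\<close>
    define l r where "l = min (\<phi> s0) \<beta> - 1" and "r = max (\<phi> s0) \<beta> + 1"
    have lr: "l < \<phi> s0" "\<phi> s0 < r" "l < \<beta>" "\<beta> < r"
      by (auto simp: l_def r_def)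
    have "(H has_vector_derivative support_fun K \<beta>) (at \<beta> within {l..r})"
      unfolding H_def by (rule interval_integral_FTC2) (use lr in \<open>auto intro: continuous_support_fun body\<close>)
    then have "(H has_vector_derivative support_fun K \<beta>) (at \<beta>)"
      using lr by (simp add: at_within_Icc_at)
    then show ?thesis by (simp add: has_real_derivative_iff_has_vector_derivative)
  qed
  from arc_length_formula[OF this s(1)]
  have "tvec \<alpha> \<bullet> x s + H \<alpha> - \<sigma> * (s - s0) = tvec (\<phi> s0) \<bullet> x s0"
    using s(2) by (simp add: H_def)
  moreover have "deriv (support_fun K) (\<phi> s0) = tvec (\<phi> s0) \<bullet> x s0"
    using DERIV_imp_deriv[OF support_fun_DERIV[OF body, of "\<phi> s0"]] support_point_eq[of s0] by simp
  ultimately have eq: "tvec \<alpha> \<bullet> x s - \<sigma> * (s - s0) = - (H \<alpha> - deriv (support_fun K) (\<phi> s0))"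
    by simp
  have "angle_involute x s0 \<phi> \<alpha> = x s - (s - s0) *\<^sub>R (\<sigma> *\<^sub>R tvec \<alpha>)"
    using vector_derivative_at[OF velocity[OF s(1)]] s(2) by (simp add: angle_involute_def involute_def inv)
  also have "\<dots> = ((nvec \<alpha> \<bullet> x s) *\<^sub>R nvec \<alpha> + (tvec \<alpha> \<bullet> x s) *\<^sub>R tvec \<alpha>) - (s - s0) *\<^sub>R (\<sigma> *\<^sub>R tvec \<alpha>)"
    using frame_decomposition[of "x s" \<alpha>] by simp
  also have "\<dots> = (nvec \<alpha> \<bullet> x s) *\<^sub>R nvec \<alpha> + (tvec \<alpha> \<bullet> x s - \<sigma> * (s - s0)) *\<^sub>R tvec \<alpha>"
    by (simp add: algebra_simps)
  also have "nvec \<alpha> \<bullet> x s = support_fun K \<alpha>"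
    using support_point_eq[OF s(1)] s(2) by (simp add: support_fun_eq[OF body(1)])
  finally show ?thesis
    unfolding eq by (simp add: H_def algebra_simps)
qed

end

text \<open>
  At \<open>s\<close> the height \<open>\<langle>n, x\<rangle>\<close> in the normal direction is maximal, so the velocity is a multiple
  \<open>a t\<close> of the tangent, with \<open>\<bar>a\<bar> = 1\<close>. For an interior point \<open>y\<close> the orienting determinant equals
  \<open>a \<langle>n, x s - y\<rangle>\<close>, whose second factor is positive; so \<open>a\<close> is the orientation sign.
\<close>

lemma boundary_curve_intro:
  assumes K: "convex_body K" "C2_plus K" and x: "arc_length_param K x"
    and \<phi>: "normal_angle K x s0 \<theta>0 \<phi>" and \<sigma>: "\<sigma> = 1 \<or> \<sigma> = - 1"
    and orient: "\<forall>y\<in>interior K. \<forall>s. \<sigma> * det (vector [x s - y, vel x s] :: real^2^2) > 0"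
  obtains L where "boundary_curve K x s0 L \<sigma> \<phi>"
proof -
  obtain L where L: "L > 0" "\<And>s. x (s + L) = x s"
    using x unfolding arc_length_param_def by blast
  have n: "outer_unit_normal K (x s) (nvec (\<phi> s))" if "s \<ge> s0" for s
    using \<phi> that by (simp add: normal_angle_def)
  have closed: "closed K" using K(1) by (simp add: convex_body_def compact_imp_closed)
  have per: "x (s + real k * L) = x s" for s k
  proof (induction k)
    case (Suc k)
    then show ?case using L(2)[of "s + real k * L"] by (simp add: algebra_simps)
  qed simp
  \<comment> \<open>Points before \<open>s0\<close> matter too: at \<open>s = s0\<close> the height must be a two-sided local maximum.\<close>
  have xK: "x s \<in> K" for s
  proof -
    obtain k where "(s0 - s) / L \<le> real k" using real_arch_simple by blast
    then have "s0 \<le> s + real k * L" using L(1) by (simp add: divide_simps split: if_splits)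
    then have "x (s + real k * L) \<in> K"
      using n closed frontier_subset_closed unfolding outer_unit_normal_def by blast
    then show ?thesis by (simp add: per)
  qed
  obtain y where y: "y \<in> interior K" using K(1) by (auto simp: convex_body_def)
  have vel: "(x has_vector_derivative \<sigma> *\<^sub>R tvec (\<phi> s)) (at s)" if s: "s \<ge> s0" for s
  proof -
    let ?n = "nvec (\<phi> s)" and ?t = "tvec (\<phi> s)"
    have D: "(x has_vector_derivative vel x s) (at s)" and unit: "norm (vel x s) = 1"
      using x by (auto simp: arc_length_param_def vector_derivative_works)
    have "((\<lambda>u. ?n \<bullet> x u) has_real_derivative ?n \<bullet> vel x s) (at s)"
      using bounded_linear.has_vector_derivative[OF bounded_linear_inner_right D, of ?n]
      by (simp add: has_real_derivative_iff_has_vector_derivative)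
    then have "?n \<bullet> vel x s = 0"
      by (rule DERIV_local_max[where d=1]) (use n[OF s] xK in \<open>auto simp: outer_unit_normal_def\<close>)
    then have v: "vel x s = (?t \<bullet> vel x s) *\<^sub>R ?t"
      using frame_decomposition[of "vel x s" "\<phi> s"] by simp
    have "?n \<noteq> 0" using norm_nvec[of "\<phi> s"] by force
    then have "?n \<bullet> y < ?n \<bullet> x s"
      using interior_less_support[OF y] n[OF s] by (simp add: outer_unit_normal_def)
    moreover have "\<sigma> * ((?t \<bullet> vel x s) * (?n \<bullet> (x s - y))) > 0"
      using orient y v det_tvec[of "x s - y" "?t \<bullet> vel x s" "\<phi> s"] by (metis)
    ultimately have "\<sigma> * (?t \<bullet> vel x s) > 0"
      by (simp add: inner_diff_right zero_less_mult_iff mult.assoc[symmetric])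
    moreover have "\<bar>?t \<bullet> vel x s\<bar> = 1"
      using unit v by (metis norm_scaleR norm_tvec mult.right_neutral)
    ultimately have "?t \<bullet> vel x s = \<sigma>" using \<sigma> by auto
    then show ?thesis using D v by simp
  qed
  have "boundary_curve K x s0 L \<sigma> \<phi>"
    by unfold_locales (use K \<sigma> L \<phi> n vel in \<open>auto simp: normal_angle_def\<close>)
  then show ?thesis by (rule that)
qed

theorem theorem3p4:
  fixes K :: "(real^2) set" and x0 :: "real^2" and \<theta>0 :: real
  assumes "convex_body K" and "C2_plus K"
    and "x0 \<in> frontier K" and "outer_unit_normal K x0 (nvec \<theta>0)"
  shows "support_fun K differentiable (at \<theta>0) \<and>
    (\<forall>x s0 \<phi>. arc_length_param K x \<and> counterclockwise K x \<and> x s0 = x0 \<and>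
        normal_angle K x s0 \<theta>0 \<phi> \<longrightarrow>
      strict_mono_on {s0..} \<phi> \<and> bij_betw \<phi> {s0..} {\<theta>0..} \<and>
      (\<forall>\<alpha>\<ge>\<theta>0. angle_involute x s0 \<phi> \<alpha> =
         support_fun K \<alpha> *\<^sub>R nvec \<alpha> -
         ((LBINT \<tau>=ereal \<theta>0..ereal \<alpha>. support_fun K \<tau>) - deriv (support_fun K) \<theta>0) *\<^sub>R tvec \<alpha>)) \<and>
    (\<forall>x s0 \<phi>. arc_length_param K x \<and> clockwise K x \<and> x s0 = x0 \<and>
        normal_angle K x s0 \<theta>0 \<phi> \<longrightarrow>
      strict_antimono_on {s0..} \<phi> \<and> bij_betw \<phi> {s0..} {..\<theta>0} \<and>
      (\<forall>\<alpha>\<le>\<theta>0. angle_involute x s0 \<phi> \<alpha> =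
         support_fun K \<alpha> *\<^sub>R nvec \<alpha> -
         ((LBINT \<tau>=ereal \<theta>0..ereal \<alpha>. support_fun K \<tau>) - deriv (support_fun K) \<theta>0) *\<^sub>R tvec \<alpha>))"
proof (intro conjI allI impI; (elim conjE)?)
  show "support_fun K differentiable at \<theta>0"
    using support_fun_DERIV[OF assms(1,2)] real_differentiable_def by blast
next
  fix x s0 \<phi>
  assume x: "arc_length_param K x" "counterclockwise K x" and \<phi>: "normal_angle K x s0 \<theta>0 \<phi>"
  obtain L where "boundary_curve K x s0 L 1 \<phi>"
    using boundary_curve_intro[OF assms(1,2) x(1) \<phi>, of 1] x(2) by (auto simp: counterclockwise_def)
  then interpret boundary_curve K x s0 L 1 \<phi> .
  have \<theta>0: "\<phi> s0 = \<theta>0" using \<phi> by (simp add: normal_angle_def)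
  show mono: "strict_mono_on {s0..} \<phi>"
    using angle_strict_mono by (auto simp: strict_mono_on_def)
  have "\<phi> ` {s0..} = {\<theta>0..}"
    using angle_surj \<theta>0 strict_mono_on_leD[OF mono, of s0] by (fastforce simp: image_iff)
  then show "bij_betw \<phi> {s0..} {\<theta>0..}" using angle_inj by (simp add: bij_betw_def)
  show "angle_involute x s0 \<phi> \<alpha> = support_fun K \<alpha> *\<^sub>R nvec \<alpha> -
      ((LBINT \<tau>=ereal \<theta>0..ereal \<alpha>. support_fun K \<tau>) - deriv (support_fun K) \<theta>0) *\<^sub>R tvec \<alpha>"
    if "\<alpha> \<ge> \<theta>0" for \<alpha>
    using angle_involute_formula[of \<alpha>] that \<theta>0 by simp
next
  fix x s0 \<phi>
  assume x: "arc_length_param K x" "clockwise K x" and \<phi>: "normal_angle K x s0 \<theta>0 \<phi>"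
  obtain L where "boundary_curve K x s0 L (- 1) \<phi>"
    using boundary_curve_intro[OF assms(1,2) x(1) \<phi>, of "- 1"] x(2) by (auto simp: clockwise_def)
  then interpret boundary_curve K x s0 L "- 1" \<phi> .
  have \<theta>0: "\<phi> s0 = \<theta>0" using \<phi> by (simp add: normal_angle_def)
  show "strict_antimono_on {s0..} \<phi>"
    using angle_strict_mono by (auto simp: monotone_on_def)
  have "\<phi> s \<le> \<theta>0" if "s \<ge> s0" for s
    using angle_strict_mono[of s0 s] that \<theta>0 by (cases "s = s0") auto
  then have "\<phi> ` {s0..} = {..\<theta>0}"
    using angle_surj \<theta>0 by (fastforce simp: image_iff)
  then show "bij_betw \<phi> {s0..} {..\<theta>0}" using angle_inj by (simp add: bij_betw_def)
  show "angle_involute x s0 \<phi> \<alpha> = support_fun K \<alpha> *\<^sub>R nvec \<alpha> -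
      ((LBINT \<tau>=ereal \<theta>0..ereal \<alpha>. support_fun K \<tau>) - deriv (support_fun K) \<theta>0) *\<^sub>R tvec \<alpha>"
    if "\<alpha> \<le> \<theta>0" for \<alpha>
    using angle_involute_formula[of \<alpha>] that \<theta>0 by simp
qed

end
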